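(* The circulant graphs $C_{54}(1,3,17,19)$ and $C_{54}(5,13,21,23)$ are isomorphic, but they are neither Type-1 isomorphic nor Type-2 isomorphic with respect to $m=3$.
   Context: For $n\in\mathbb{N}$ and a set $R\subseteq[1,\frac n2]$ of positive integers (jump sizes), $C_n(R)$ is the circulant graph with vertices $v_0,\dots,v_{n-1}$ and edges $(v_i,v_{i+r})$ for $i\in\mathbb{Z}_n$, $r\in R$, subscripts modulo $n$; $C_n(r_1,\dots,r_k)$ means $C_n(\{r_1,\dots,r_k\})$. Reflexive reduction modulo $n$: reduce each integer modulo $n$ and replace any result $r'$ with $r'>\frac n2$ by $n-r'$. Let $\varphi_n$ be the set of integers $x$, taken modulo $n$, with $\gcd(n,x)=1$. For $x\in\varphi_n$, $xR$ denotes the reflexive reduction modulo $n$ of $\{xr: r\in R\}$. Type-1 isomorphism (Adam's isomorphism): $C_n(R)$ and $C_n(S)$ are Type-1 isomorphic if $S=xR$ for some $x\in\varphi_n$. Type-2 isomorphism: let $|R|\ge 3$, $r\in R$, and $m>1$ be such that $m$ divides $\gcd(n,r)$ and $m^3$ divides $n$. Let $K_n$ be the complete graph on $u_0,\dots,u_{n-1}$. For $0\le t\le \frac nm-1$ define the one-to-one map $\theta_{n,m,t}:V(C_n(R))\to V(K_n)$ by $\theta_{n,m,t}(v_x)=u_{x+jtm}$ (subscripts modulo $n$), where $x=qm+j$, $0\le j\le m-1$, $0\le q\le\frac nm-1$. It acts on edges by $\theta_{n,m,t}((v_x,v_{x+s}))=(\theta_{n,m,t}(v_x),\theta_{n,m,t}(v_{x+s}))$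 for $s\in R$, and $\theta_{n,m,t}(C_n(R))$ is the resulting graph on $u_0,\dots,u_{n-1}$. If for some $t$ one has $\theta_{n,m,t}(C_n(R))=C_n(S)$ (the circulant graph on $u_0,\dots,u_{n-1}$) for some $S$ and $S\ne yR$ for all $y\in\varphi_n$, then $C_n(R)$ and $C_n(S)$ are called Type-2 isomorphic with respect to $m$. When $C_n(R)$ and $C_n(S)$ are Type-2 isomorphic with respect to $m$, one also says, for $k\in\mathbb{N}$, that $C_{kn}(kR)$ and $C_{kn}(kS)$ are Type-2 isomorphic with respect to $m$. *)

theory Defs
  imports "Graph_Theory.Graph_Theory"
begin

definition jump_set :: "nat \<Rightarrow> nat set \<Rightarrow> bool" where
  "jump_set n R \<longleftrightarrow> (\<forall>r\<in>R. 1 \<le> r \<and> 2 * r \<le> n)"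

text \<open>The vertex with subscript \<open>i\<close> is the number \<open>i\<close>. As usual in \<open>Graph_Theory\<close>, an
  undirected edge is represented by its two opposite arcs.\<close>

definition circulant :: "nat \<Rightarrow> nat set \<Rightarrow> nat pair_pre_digraph" where
  "circulant n R = \<lparr> pverts = {..<n},
     parcs = {(i, (i + r) mod n) | i r. i < n \<and> r \<in> R} \<union>
             {((i + r) mod n, i) | i r. i < n \<and> r \<in> R} \<rparr>"

lemma pair_graph_circulant:
  assumes "jump_set n R"
  shows "pair_graph (circulant n R)"
proof -
  have ne: "(i + r) mod n \<noteq> i" if "i < n" "r \<in> R" for i r
  proof -
    from assms that have r: "1 \<le> r" "2 * r \<le> n" by (auto simp: jump_set_def)
    show ?thesis
    proof (cases "i + r < n")
      case False
      then have "(i + r) mod n = i + r - n" using r that by (simp add: mod_if)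
      then show ?thesis using False r that by linarith
    qed (use r in simp)
  qed
  have sub: "parcs (circulant n R) \<subseteq> {..<n} \<times> {..<n}"
    by (auto simp: circulant_def intro!: mod_less_divisor)
  have "finite (parcs (circulant n R))"
    by (rule finite_subset[OF sub]) simp
  moreover have "symmetric (with_proj (circulant n R))"
    by (auto simp: symmetric_def sym_def circulant_def)
  moreover have "fst e \<noteq> snd e" if "e \<in> parcs (circulant n R)" for e
  proof -
    from that obtain i r where "i < n" "r \<in> R"
      "e = (i, (i + r) mod n) \<or> e = ((i + r) mod n, i)"
      by (auto simp: circulant_def)
    with ne[of i r] show ?thesis by auto
  qed
  ultimately show ?thesis
    using sub by unfold_locales (auto simp: circulant_def)
qed

definition reflexive_mod :: "nat \<Rightarrow> nat \<Rightarrow> nat" where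
  "reflexive_mod n x = (let x' = x mod n in if 2 * x' > n then n - x' else x')"

definition phi :: "nat \<Rightarrow> nat set" where
  "phi n = {x. x < n \<and> gcd n x = 1}"

definition mult_jumps :: "nat \<Rightarrow> nat \<Rightarrow> nat set \<Rightarrow> nat set" where
  "mult_jumps n x R = (\<lambda>r. reflexive_mod n (x * r)) ` R"

definition type1_isomorphic :: "nat \<Rightarrow> nat set \<Rightarrow> nat set \<Rightarrow> bool" where
  "type1_isomorphic n R S \<longleftrightarrow>
     jump_set n R \<and> jump_set n S \<and> (\<exists>x\<in>phi n. S = mult_jumps n x R)"

definition theta :: "nat \<Rightarrow> nat \<Rightarrow> nat \<Rightarrow> nat \<Rightarrow> nat" where
  "theta n m t x = (x + (x mod m) * t * m) mod n"

definition theta_graph :: "nat \<Rightarrow> nat \<Rightarrow> nat \<Rightarrow> nat set \<Rightarrow> nat pair_pre_digraph" where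
  "theta_graph n m t R = \<lparr> pverts = {..<n},
     parcs = (\<lambda>(a, b). (theta n m t a, theta n m t b)) ` parcs (circulant n R) \<rparr>"

text \<open>The rule \<open>scale\<close> is the convention extending the notion from \<open>C\<^sub>n(R), C\<^sub>n(S)\<close> to
  \<open>C\<^sub>k\<^sub>n(kR), C\<^sub>k\<^sub>n(kS)\<close>; no reduction is needed, as \<open>kr \<le> kn/2\<close> for every \<open>r \<le> n/2\<close>.\<close>

inductive type2_isomorphic :: "nat \<Rightarrow> nat \<Rightarrow> nat set \<Rightarrow> nat set \<Rightarrow> bool" where
  base: "type2_isomorphic n m R S"
    if "jump_set n R" "jump_set n S" "card R \<ge> 3"
      "r \<in> R" "m > 1" "m dvd gcd n r" "m ^ 3 dvd n"
      "t \<le> n div m - 1" "theta_graph n m t R = circulant n S"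
      "\<forall>y\<in>phi n. S \<noteq> mult_jumps n y R"
| scale: "type2_isomorphic (k * n) m ((*) k ` R) ((*) k ` S)"
    if "type2_isomorphic n m R S" "k \<ge> 1"

end

theory Submission
  imports Defs
begin

text \<open>
  The isomorphism is \<open>f(x) = 5x + 18\<lfloor>x/3\<rfloor>\<close> modulo 54. Taken with both signs, the jumps 1, 17, 19
  are exactly the residues \<open>\<plusminus>1\<close> modulo 18, and 5, 13, 23 are exactly the residues \<open>\<plusminus>5\<close> modulo 18;
  since \<open>f\<close> is multiplication by 5 modulo 18 (\<open>f54_diff_mod_18\<close>), it carries the first kind of
  edge to the second. The remaining jumps 3 and 21 are multiples of 3, and on differences
  divisible by 3 the floor term makes \<open>f\<close> act as multiplication by \<open>5 + 18/3 = 11\<close>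
  (\<open>f54_diff_multiple_3\<close>), with \<open>11 \<cdot> 3 = 33 \<equiv> -21\<close> modulo 54. The lemma \<open>jumps_correspond\<close>
  combines the two, in both directions.

  No single unit \<open>y\<close> does both: the jump 3 would have to go to the only multiple of 3, and
  \<open>3y \<equiv> \<plusminus>21\<close> modulo 54 forces \<open>y \<equiv> \<plusminus>7\<close> modulo 18, whereas the jump 1 would have to go to 5, 13
  or 23, that is, \<open>y \<equiv> \<plusminus>5\<close> modulo 18. This excludes Type 1.

  The map \<open>\<theta>\<close> for \<open>m = 3\<close> fixes all multiples of 3, so it keeps the edge from 0 to 3
  (\<open>theta_graph_keeps_multiple\<close>), but 3 is not among the jumps 5, 13, 21, 23. Scaling cannot
  help either, because the jump 1 is a multiple of \<open>k\<close> only for \<open>k = 1\<close>. This excludes Type 2.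
\<close>

section \<open>Isomorphisms of circulant graphs\<close>

lemma circulant_arc_iff:
  "(a, b) \<in> parcs (circulant n R) \<longleftrightarrow> a < n \<and> b < n \<and>
     (\<exists>r\<in>R. int n dvd int b - int a - int r \<or> int n dvd int b - int a + int r)"
proof -
  have step: "b = (a + r) mod n \<longleftrightarrow> int n dvd int b - int a - int r" if "b < n" for a b r
  proof -
    have "b = (a + r) mod n \<longleftrightarrow> int b mod int n = (int a + int r) mod int n"
      using that by (metis mod_less of_nat_add of_nat_eq_iff zmod_int)
    then show ?thesis by (simp add: mod_eq_dvd_iff algebra_simps)
  qed
  have neg: "int n dvd int a - int b - int r \<longleftrightarrow> int n dvd int b - int a + int r" for r
    by (metis add.commute dvd_minus_iff minus_diff_eq diff_minus_eq_add)
  have "(a, b) \<in> parcs (circulant n R) \<longleftrightarrow> a < n \<and> b < n \<and>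
     (\<exists>r\<in>R. b = (a + r) mod n \<or> a = (b + r) mod n)"
    by (auto simp: circulant_def)
  then show ?thesis using step neg by metis
qed

lemma digraph_iso_with_projI:
  assumes bij: "bij_betw f (pverts G) (pverts H)"
    and wf: "pair_wf_digraph G" "pair_wf_digraph H"
    and arcs: "\<And>u v. u \<in> pverts G \<Longrightarrow> v \<in> pverts G \<Longrightarrow>
      (f u, f v) \<in> parcs H \<longleftrightarrow> (u, v) \<in> parcs G"
  shows "digraph_iso (with_proj G) (with_proj H)"
proof -
  define hom where
    "hom = \<lparr>iso_verts = f, iso_arcs = map_prod f f, iso_head = snd, iso_tail = fst\<rparr>"
  have inj: "inj_on f (pverts G)" and img: "f ` pverts G = pverts H"
    using bij by (auto simp: bij_betw_def)
  have subG: "parcs G \<subseteq> pverts G \<times> pverts G" and subH: "parcs H \<subseteq> pverts H \<times> pverts H"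
    using wf by (auto dest: pair_wf_digraph.in_arcsD1 pair_wf_digraph.in_arcsD2)
  have "inj_on (map_prod f f) (parcs G)"
    using map_prod_inj_on[OF inj inj] subG by (rule inj_on_subset)
  moreover have "map_prod f f ` parcs G = parcs H"
  proof
    show "map_prod f f ` parcs G \<subseteq> parcs H" using subG arcs by fastforce
    show "parcs H \<subseteq> map_prod f f ` parcs G"
    proof
      fix e assume e: "e \<in> parcs H"
      then have "fst e \<in> f ` pverts G" "snd e \<in> f ` pverts G"
        using subH img by auto
      then obtain u v where "e = (f u, f v)" "u \<in> pverts G" "v \<in> pverts G"
        by (metis imageE prod.collapse)
      with e arcs show "e \<in> map_prod f f ` parcs G" by force
    qed
  qed
  moreover have "wf_digraph (with_proj G)"
    using wf(1) by (simp add: wf_digraph_wp_iff)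
  ultimately show ?thesis
    unfolding digraph_iso_def
    by (intro exI[of _ hom])
       (use inj img in \<open>simp_all add: pre_digraph.digraph_isomorphism_def app_iso_def
         with_proj_def hom_def\<close>)
qed

section \<open>Congruences modulo 18 and 54\<close>

lemma dvd_diff_mult_iff:
  fixes k a x y z :: int
  assumes "k dvd x - a * y" "coprime k a"
  shows "k dvd x - a * z \<longleftrightarrow> k dvd y - z"
proof -
  have "x - a * z = (x - a * y) + a * (y - z)" by (simp add: algebra_simps)
  then show ?thesis using assms by (metis dvd_add_right_iff coprime_dvd_mult_right_iff)
qed

text \<open>A residue modulo 18 splits into three residues modulo 54; this is what turns the jumps
  1, 17, 19 (or 5, 13, 23), taken with both signs, into a condition modulo 18.\<close>

lemma dvd_18_iff_dvd_54:
  fixes x :: int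
  shows "18 dvd x \<longleftrightarrow> 54 dvd x \<or> 54 dvd x - 18 \<or> 54 dvd x + 18"
proof
  assume "18 dvd x"
  then obtain k where k: "x = 18 * k" by (rule dvdE)
  have "3 dvd k \<or> 3 dvd k - 1 \<or> 3 dvd k + 1" by presburger
  then have "18 * 3 dvd 18 * k \<or> 18 * 3 dvd 18 * (k - 1) \<or> 18 * 3 dvd 18 * (k + 1)"
    by (metis mult_dvd_mono dvd_refl)
  then show "54 dvd x \<or> 54 dvd x - 18 \<or> 54 dvd x + 18"
    unfolding k by (simp add: algebra_simps)
next
  have 18: "54 dvd y \<Longrightarrow> 18 dvd y" for y :: int
    using dvd_trans[of 18 54 y] by simp
  assume "54 dvd x \<or> 54 dvd x - 18 \<or> 54 dvd x + 18"
  then have "18 dvd x \<or> 18 dvd x - 18 \<or> 18 dvd x + 18" using 18 by blast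
  then show "18 dvd x" by (metis dvd_refl dvd_add_left_iff dvd_diff_left_iff)
qed

section \<open>The isomorphism\<close>

definition f54 :: "nat \<Rightarrow> nat" where
  "f54 x = (5 * x + 18 * (x div 3)) mod 54"

text \<open>Adding 54 to \<open>x\<close> changes \<open>5x + 18\<lfloor>x/3\<rfloor>\<close> by \<open>5 \<cdot> 54 + 18 \<cdot> 18 = 11 \<cdot> 54\<close>, so the map makes
  sense on residues modulo 54. Accordingly the two congruences derived from the next lemma
  involve \<open>v - u\<close> only through its residue, and edges that wrap around need no separate case.\<close>

lemma f54_diff_unreduced:
  "54 dvd (int (f54 v) - int (f54 u)) -
     (5 * (int v - int u) + 18 * (int v div 3 - int u div 3))"
proof -
  have "54 dvd int (f54 x) - (5 * int x + 18 * (int x div 3))" for x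
    unfolding f54_def zmod_int mod_eq_dvd_iff[symmetric] by (simp add: zdiv_int)
  from dvd_diff[OF this[of v] this[of u]] show ?thesis by (simp add: algebra_simps)
qed

lemma f54_diff_multiple_3:
  assumes "3 dvd int v - int u"
  shows "54 dvd (int (f54 v) - int (f54 u)) - 11 * (int v - int u)"
proof -
  obtain k where k: "int v - int u = 3 * k" using assms by (rule dvdE)
  then have "int v = int u + 3 * k" by simp
  then have "int v div 3 - int u div 3 = k" by simp
  with f54_diff_unreduced[of v u] k show ?thesis by simp
qed

lemma f54_diff_mod_18:
  "18 dvd (int (f54 v) - int (f54 u)) - 5 * (int v - int u)"
proof -
  have "18 dvd (int (f54 v) - int (f54 u)) - 5 * (int v - int u)
      - 18 * (int v div 3 - int u div 3)"
    using dvd_trans[OF _ f54_diff_unreduced[of v u], of 18] by (simp add: algebra_simps)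
  then show ?thesis by (metis dvd_diff_left_iff dvd_triv_left)
qed

lemma source_arc_iff:
  "(u, v) \<in> parcs (circulant 54 {1, 3, 17, 19}) \<longleftrightarrow> u < 54 \<and> v < 54 \<and>
     (18 dvd int v - int u - 1 \<or> 18 dvd int v - int u + 1 \<or>
      54 dvd int v - int u - 3 \<or> 54 dvd int v - int u + 3)"
  unfolding circulant_arc_iff
    dvd_18_iff_dvd_54[of "int v - int u - 1"] dvd_18_iff_dvd_54[of "int v - int u + 1"]
  by (simp add: algebra_simps) argo

lemma target_arc_iff:
  "(u, v) \<in> parcs (circulant 54 {5, 13, 21, 23}) \<longleftrightarrow> u < 54 \<and> v < 54 \<and>
     (18 dvd int v - int u - 5 \<or> 18 dvd int v - int u + 5 \<or>
      54 dvd int v - int u - 21 \<or> 54 dvd int v - int u + 21)"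
  unfolding circulant_arc_iff
    dvd_18_iff_dvd_54[of "int v - int u - 5"] dvd_18_iff_dvd_54[of "int v - int u + 5"]
  by (simp add: algebra_simps) argo

text \<open>Here \<open>d\<close> is the difference of two vertices and \<open>e\<close> that of their images.
  Of the four alternatives on either side, the ones modulo 18 can hold only for differences
  prime to 3 and the ones modulo 54 only for multiples of 3, and \<open>d\<close> and \<open>e\<close> are of the same
  kind. So the jumps of each kind are matched separately, each by its own multiplier.\<close>

lemma jumps_correspond:
  fixes d e :: int
  assumes e18: "18 dvd e - 5 * d" and e54: "3 dvd d \<Longrightarrow> 54 dvd e - 11 * d"
  shows "(18 dvd e - 5 \<or> 18 dvd e + 5 \<or> 54 dvd e - 21 \<or> 54 dvd e + 21) \<longleftrightarrow>
         (18 dvd d - 1 \<or> 18 dvd d + 1 \<or> 54 dvd d - 3 \<or> 54 dvd d + 3)"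
proof -
  have 3: "(18 dvd y \<longrightarrow> 3 dvd y) \<and> (54 dvd y \<longrightarrow> 3 dvd y)" for y :: int
    using dvd_trans[of 3 18 y] dvd_trans[of 3 54 y] by simp
  have e3: "3 dvd e \<longleftrightarrow> 3 dvd d"
  proof -
    have "3 dvd e - 5 * d" using 3 e18 by blast
    then show ?thesis by presburger
  qed
  show ?thesis
  proof (cases "3 dvd d")
    case True
    have "coprime (54 :: int) 11" by (simp add: coprime_iff_gcd_eq_1 gcd_non_0_int)
    from dvd_diff_mult_iff[OF e54[OF True] this, of "- 3"]
      dvd_diff_mult_iff[OF e54[OF True] this, of 3]
    have "54 dvd e + 33 \<longleftrightarrow> 54 dvd d + 3" "54 dvd e - 33 \<longleftrightarrow> 54 dvd d - 3"
      by simp_all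
    moreover have "54 dvd e + 33 \<longleftrightarrow> 54 dvd e - 21" "54 dvd e - 33 \<longleftrightarrow> 54 dvd e + 21"
      using dvd_add_left_iff[of 54 54 "e - 21"] dvd_add_left_iff[of 54 54 "e - 33"]
      by (simp_all add: add.commute)
    moreover have "\<not> 3 dvd e - 5" "\<not> 3 dvd e + 5" "\<not> 3 dvd d - 1" "\<not> 3 dvd d + 1"
      using True e3 by presburger+
    ultimately show ?thesis using 3 by blast
  next
    case False
    have "coprime (18 :: int) 5" by (simp add: coprime_iff_gcd_eq_1 gcd_non_0_int)
    from dvd_diff_mult_iff[OF e18 this, of 1] dvd_diff_mult_iff[OF e18 this, of "- 1"]
    have "18 dvd e - 5 \<longleftrightarrow> 18 dvd d - 1" "18 dvd e + 5 \<longleftrightarrow> 18 dvd d + 1"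
      by simp_all
    moreover have "\<not> 3 dvd e - 21" "\<not> 3 dvd e + 21" "\<not> 3 dvd d - 3" "\<not> 3 dvd d + 3"
      using False e3 by presburger+
    ultimately show ?thesis using 3 by blast
  qed
qed

lemma f54_arc_iff:
  assumes "u < 54" "v < 54"
  shows "(f54 u, f54 v) \<in> parcs (circulant 54 {5, 13, 21, 23}) \<longleftrightarrow>
         (u, v) \<in> parcs (circulant 54 {1, 3, 17, 19})"
proof -
  have "f54 u < 54" "f54 v < 54" by (simp_all add: f54_def)
  with assms show ?thesis
    unfolding source_arc_iff target_arc_iff
    using jumps_correspond[OF f54_diff_mod_18 f54_diff_multiple_3, of v u] by blast
qed

lemma bij_betw_f54: "bij_betw f54 {..<54} {..<54}"
proof -
  have "inj_on f54 {..<54}"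
  proof (rule inj_onI)
    fix u v :: nat
    assume uv: "u \<in> {..<54}" "v \<in> {..<54}" and eq: "f54 u = f54 v"
    \<comment> \<open>The congruence modulo 18 comes first: it yields the divisibility by 3 without which
      the sharper one modulo 54 is not available.\<close>
    have "18 dvd int v - int u"
      using dvd_diff_mult_iff[OF f54_diff_mod_18, of v u 0] eq
      by (simp add: coprime_iff_gcd_eq_1 gcd_non_0_int)
    then have "3 dvd int v - int u" using dvd_trans[of 3 18 "int v - int u"] by simp
    from dvd_diff_mult_iff[OF f54_diff_multiple_3[OF this], of 0] eq
    have "54 dvd int v - int u" by (simp add: coprime_iff_gcd_eq_1 gcd_non_0_int)
    then have "int v mod 54 = int u mod 54" by (simp add: mod_eq_dvd_iff)
    then show "u = v" using uv by simp
  qed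
  moreover have "f54 ` {..<54} \<subseteq> {..<54}" by (auto simp: f54_def)
  ultimately show ?thesis by (simp add: bij_betw_def endo_inj_surj)
qed

section \<open>Multipliers\<close>

lemma mod_reflexive_mod_cases:
  assumes "n > 0"
  shows "x mod n = reflexive_mod n x \<or> x mod n = n - reflexive_mod n x"
  using assms by (simp add: reflexive_mod_def Let_def)

lemma not_mult_jumps:
  assumes "x \<in> phi 54"
  shows "{5, 13, 21, 23} \<noteq> mult_jumps 54 x {1, 3, 17, 19}"
proof
  assume eq: "{5, 13, 21, 23} = mult_jumps 54 x {1, 3, 17, 19}"
  then have "reflexive_mod 54 x \<in> {5, 13, 21, 23}"
    "reflexive_mod 54 (x * 3) \<in> {5, 13, 21, 23}"
    by (auto simp: mult_jumps_def)
  \<comment> \<open>the residues whose reflexive reduction lies in the target set, i.e. \<open>\<plusminus>5, \<plusminus>13, \<plusminus>21, \<plusminus>23\<close>\<close>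
  then have A: "x mod 54 \<in> {5, 13, 21, 23, 31, 33, 41, 49}"
      "(3 * x) mod 54 \<in> {5, 13, 21, 23, 31, 33, 41, 49}"
    using mod_reflexive_mod_cases[of 54 x] mod_reflexive_mod_cases[of 54 "x * 3"]
    unfolding mult.commute[of x 3] by auto
  have "\<not> 3 dvd x"
  proof
    assume "3 dvd x"
    then have "3 dvd gcd 54 x" by simp
    moreover have "gcd 54 x = 1" using assms by (simp add: phi_def)
    ultimately have "3 dvd (1 :: nat)" by metis
    then show False by simp
  qed
  then have "x mod 54 \<noteq> 21 \<and> x mod 54 \<noteq> 33"
    using dvd_mod_iff[of 3 54 x] by auto
  moreover have "(3 * x) mod 54 = (3 * (x mod 54)) mod 54" by (simp only: mod_mult_right_eq)
  ultimately show False using A by auto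
qed

section \<open>The maps \<open>\<theta>\<close>\<close>

lemma theta_fixes_multiples: "m dvd x \<Longrightarrow> x < n \<Longrightarrow> theta n m t x = x"
  by (auto simp: theta_def)

lemma theta_graph_keeps_multiple:
  assumes "r \<in> R" "m dvd r" "r < n"
  shows "(0, r) \<in> parcs (theta_graph n m t R)"
proof -
  have "(0, r) \<in> parcs (circulant n R)"
    unfolding circulant_arc_iff using assms by (auto intro: bexI[of _ r])
  moreover have "theta n m t 0 = 0" "theta n m t r = r"
    using assms by (simp_all add: theta_fixes_multiples)
  ultimately show ?thesis
    unfolding theta_graph_def by (force intro: rev_image_eqI)
qed

text \<open>The sets and the modulus are equated with variables because the rule for scaling
  changes them; this is an induction whose only recursive case collapses to \<open>k = 1\<close>.\<close>

lemma not_type2: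
  assumes "type2_isomorphic n m R S"
    and "n = 54" "m = 3" "R = {1, 3, 17, 19}" "S = {5, 13, 21, 23}"
  shows False
  using assms
proof induction
  case (base n R S r m t)
  then have "(0, 3) \<in> parcs (circulant 54 {5, 13, 21, 23})"
    using theta_graph_keeps_multiple[of 3 R m n t] by simp
  then show False by (simp add: target_arc_iff)
next
  case (scale n m R S k)
  have "1 \<in> (*) k ` R" using scale.prems by simp
  then have "k = 1" by auto
  with scale show False by simp
qed

section \<open>The two graphs on 54 vertices\<close>

theorem mainTheorem1:
  shows "digraph_iso (with_proj (circulant 54 {1, 3, 17, 19}))
                     (with_proj (circulant 54 {5, 13, 21, 23})) \<and>
         \<not> type1_isomorphic 54 {1, 3, 17, 19} {5, 13, 21, 23} \<and>
         \<not> type2_isomorphic 54 3 {1, 3, 17, 19} {5, 13, 21, 23}"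
proof (intro conjI)
  have wf: "pair_wf_digraph (circulant 54 R)" for R
    by unfold_locales (auto simp: circulant_arc_iff, auto simp: circulant_def)
  have verts: "pverts (circulant 54 R) = {..<54}" for R
    by (simp add: circulant_def)
  show "digraph_iso (with_proj (circulant 54 {1, 3, 17, 19}))
                    (with_proj (circulant 54 {5, 13, 21, 23}))"
    by (rule digraph_iso_with_projI[of f54])
       (use wf bij_betw_f54 f54_arc_iff verts in auto)
  show "\<not> type1_isomorphic 54 {1, 3, 17, 19} {5, 13, 21, 23}"
    using not_mult_jumps by (auto simp: type1_isomorphic_def)
  show "\<not> type2_isomorphic 54 3 {1, 3, 17, 19} {5, 13, 21, 23}"
    using not_type2 by blast
qed

end
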